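(* Let $(!,\delta,\varepsilon,\Delta,e,\nabla,u)$ be an additive bialgebra modality on an additive symmetric monoidal category, and let $\mathsf{d}:{!A}\otimes A\to{!A}$ be a natural transformation satisfying the linear rule $\mathsf{d}\varepsilon=e\otimes 1$. Then the following are equivalent: (i) $\mathsf{d}$ satisfies the product (Leibniz) rule $\mathsf{d}\Delta=(\Delta\otimes1)\big((1\otimes\mathsf{d})+(1\otimes\sigma)(\mathsf{d}\otimes1)\big)$; (ii) $\mathsf{d}$ satisfies the $\nabla$-rule $(\nabla\otimes1)\mathsf{d}=(1\otimes\mathsf{d})\nabla$.
   Context: Composition is in diagrammatic order ($fg$ means first $f$, then $g$). Symmetric monoidal categories are treated as strict (associators and unitors suppressed), with tensor $\otimes$, unit $K$, symmetry $\sigma:A\otimes B\to B\otimes A$. An additive symmetric monoidal category is a symmetric monoidal category enriched in commutative monoids (hom-sets have $+$ and $0$, no negatives, no biproducts assumed), with composition and $\otimes$ preserving $+$ and $0$ in each variable. A coalgebra modality $(!,\delta,\varepsilon,\Delta,e)$ is a comonad $(!,\delta,\varepsilon)$, $\delta:{!A}\to{!!A}$, $\varepsilon:{!A}\to A$, with natural transformations $\Delta:{!A}\to{!A}\otimes{!A}$, $e:{!A}\to K$ such that each $({!A},\Delta,e)$ is a cocommutative comonoid and $\delta\Delta=\Delta(\delta\otimes\delta)$. A bialgebra modality $(!,\delta,\varepsilon,\Delta,e,\nabla,u)$ is a coalgebra modality with natural transformations $\nabla:{!A}\otimes{!A}\to{!A}$, $u:K\to{!A}$ such that $({!A},\nabla,u)$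 is a commutative monoid, $\nabla e=e\otimes e$, $u\Delta=u\otimes u$, $ue=1$, $\nabla\Delta=(\Delta\otimes\Delta)(1\otimes\sigma\otimes1)(\nabla\otimes\nabla)$, and $\nabla\varepsilon=\varepsilon\otimes e+e\otimes\varepsilon$. It is additive if for all parallel maps $f,g$: $!(f+g)=\Delta(!(f)\otimes!(g))\nabla$ and $!(0)=eu$. *)

theory Defs
  imports Main
begin

(* Composition is in diagrammatic order: f \<cdot> g is first f, then g. *)
record ('o, 'm) cat =
  Ob :: "'o set"
  Ar :: "'m set"
  Dom :: "'m \<Rightarrow> 'o"
  Cod :: "'m \<Rightarrow> 'o"
  ident :: "'o \<Rightarrow> 'm"  ("\<one>\<index>")
  comp :: "'m \<Rightarrow> 'm \<Rightarrow> 'm"  (infixl "\<cdot>\<index>" 70)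

record ('o, 'm) smc = "('o, 'm) cat" +
  tensor_ob :: "'o \<Rightarrow> 'o \<Rightarrow> 'o"  (infixl "\<otimes>\<^sub>o\<index>" 75)
  tensor :: "'m \<Rightarrow> 'm \<Rightarrow> 'm"  (infixl "\<otimes>\<index>" 75)
  unit_ob :: "'o"  ("K\<index>")
  symm :: "'o \<Rightarrow> 'o \<Rightarrow> 'm"  ("\<sigma>\<index>")

record ('o, 'm) asmc = "('o, 'm) smc" +
  add :: "'m \<Rightarrow> 'm \<Rightarrow> 'm"  (infixl "\<oplus>\<index>" 65)
  zero :: "'o \<Rightarrow> 'o \<Rightarrow> 'm"  ("\<zero>\<index>")

definition Hom :: "('o, 'm, 'z) cat_scheme \<Rightarrow> 'o \<Rightarrow> 'o \<Rightarrow> 'm set"  ("Hom\<index>") where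
  "Hom\<^bsub>C\<^esub> X Y = {f \<in> Ar C. Dom C f = X \<and> Cod C f = Y}"

locale category =
  fixes C :: "('o, 'm, 'z) cat_scheme" (structure)
  assumes dom_ob: "f \<in> Ar C \<Longrightarrow> Dom C f \<in> Ob C"
    and cod_ob: "f \<in> Ar C \<Longrightarrow> Cod C f \<in> Ob C"
    and id_hom: "X \<in> Ob C \<Longrightarrow> \<one> X \<in> Hom X X"
    and comp_hom: "f \<in> Hom X Y \<Longrightarrow> g \<in> Hom Y Z \<Longrightarrow> f \<cdot> g \<in> Hom X Z"
    and id_comp: "f \<in> Hom X Y \<Longrightarrow> \<one> X \<cdot> f = f"
    and comp_id: "f \<in> Hom X Y \<Longrightarrow> f \<cdot> \<one> Y = f"
    and comp_assoc:
      "f \<in> Hom W X \<Longrightarrow> g \<in> Hom X Y \<Longrightarrow> h \<in> Hom Y Z \<Longrightarrow> (f \<cdot> g) \<cdot> h = f \<cdot> (g \<cdot> h)"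

(* Strict symmetric monoidal categories: associators and unitors are identities. The unit
   coherence of the symmetry, \<sigma> X K = \<one> X, follows from the hexagon and invertibility. *)
locale symmetric_monoidal_category = category C
  for C :: "('o, 'm, 'z) smc_scheme" (structure) +
  assumes unit_ob: "K \<in> Ob C"
    and tensor_ob: "X \<in> Ob C \<Longrightarrow> Y \<in> Ob C \<Longrightarrow> X \<otimes>\<^sub>o Y \<in> Ob C"
    and tensor_ob_assoc:
      "X \<in> Ob C \<Longrightarrow> Y \<in> Ob C \<Longrightarrow> Z \<in> Ob C \<Longrightarrow> (X \<otimes>\<^sub>o Y) \<otimes>\<^sub>o Z = X \<otimes>\<^sub>o (Y \<otimes>\<^sub>o Z)"
    and tensor_ob_unit_left: "X \<in> Ob C \<Longrightarrow> K \<otimes>\<^sub>o X = X"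
    and tensor_ob_unit_right: "X \<in> Ob C \<Longrightarrow> X \<otimes>\<^sub>o K = X"
    and tensor_hom:
      "f \<in> Hom X Y \<Longrightarrow> g \<in> Hom X' Y' \<Longrightarrow> f \<otimes> g \<in> Hom (X \<otimes>\<^sub>o X') (Y \<otimes>\<^sub>o Y')"
    and tensor_id: "X \<in> Ob C \<Longrightarrow> Y \<in> Ob C \<Longrightarrow> \<one> X \<otimes> \<one> Y = \<one> (X \<otimes>\<^sub>o Y)"
    and tensor_comp:
      "f \<in> Hom X Y \<Longrightarrow> g \<in> Hom Y Z \<Longrightarrow> f' \<in> Hom X' Y' \<Longrightarrow> g' \<in> Hom Y' Z' \<Longrightarrow>
        (f \<cdot> g) \<otimes> (f' \<cdot> g') = (f \<otimes> f') \<cdot> (g \<otimes> g')"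
    and tensor_assoc:
      "f \<in> Ar C \<Longrightarrow> g \<in> Ar C \<Longrightarrow> h \<in> Ar C \<Longrightarrow> (f \<otimes> g) \<otimes> h = f \<otimes> (g \<otimes> h)"
    and tensor_unit_left: "f \<in> Ar C \<Longrightarrow> \<one> K \<otimes> f = f"
    and tensor_unit_right: "f \<in> Ar C \<Longrightarrow> f \<otimes> \<one> K = f"
    and symm_hom: "X \<in> Ob C \<Longrightarrow> Y \<in> Ob C \<Longrightarrow> \<sigma> X Y \<in> Hom (X \<otimes>\<^sub>o Y) (Y \<otimes>\<^sub>o X)"
    and symm_natural:
      "f \<in> Hom X Y \<Longrightarrow> g \<in> Hom X' Y' \<Longrightarrow> (f \<otimes> g) \<cdot> \<sigma> Y Y' = \<sigma> X X' \<cdot> (g \<otimes> f)"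
    and symm_symm: "X \<in> Ob C \<Longrightarrow> Y \<in> Ob C \<Longrightarrow> \<sigma> X Y \<cdot> \<sigma> Y X = \<one> (X \<otimes>\<^sub>o Y)"
    and symm_hexagon:
      "X \<in> Ob C \<Longrightarrow> Y \<in> Ob C \<Longrightarrow> Z \<in> Ob C \<Longrightarrow>
        \<sigma> X (Y \<otimes>\<^sub>o Z) = (\<sigma> X Y \<otimes> \<one> Z) \<cdot> (\<one> Y \<otimes> \<sigma> X Z)"

locale additive_symmetric_monoidal_category = symmetric_monoidal_category C
  for C :: "('o, 'm, 'z) asmc_scheme" (structure) +
  assumes zero_hom: "X \<in> Ob C \<Longrightarrow> Y \<in> Ob C \<Longrightarrow> \<zero> X Y \<in> Hom X Y"
    and add_hom: "f \<in> Hom X Y \<Longrightarrow> g \<in> Hom X Y \<Longrightarrow> f \<oplus> g \<in> Hom X Y"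
    and add_assoc:
      "f \<in> Hom X Y \<Longrightarrow> g \<in> Hom X Y \<Longrightarrow> h \<in> Hom X Y \<Longrightarrow> (f \<oplus> g) \<oplus> h = f \<oplus> (g \<oplus> h)"
    and add_commute: "f \<in> Hom X Y \<Longrightarrow> g \<in> Hom X Y \<Longrightarrow> f \<oplus> g = g \<oplus> f"
    and zero_add: "f \<in> Hom X Y \<Longrightarrow> \<zero> X Y \<oplus> f = f"
    and comp_add_left:
      "f \<in> Hom X Y \<Longrightarrow> g \<in> Hom X Y \<Longrightarrow> h \<in> Hom Y Z \<Longrightarrow> (f \<oplus> g) \<cdot> h = f \<cdot> h \<oplus> g \<cdot> h"
    and comp_add_right:
      "f \<in> Hom X Y \<Longrightarrow> g \<in> Hom Y Z \<Longrightarrow> h \<in> Hom Y Z \<Longrightarrow> f \<cdot> (g \<oplus> h) = f \<cdot> g \<oplus> f \<cdot> h"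
    and comp_zero_left: "X \<in> Ob C \<Longrightarrow> f \<in> Hom Y Z \<Longrightarrow> \<zero> X Y \<cdot> f = \<zero> X Z"
    and comp_zero_right: "f \<in> Hom X Y \<Longrightarrow> Z \<in> Ob C \<Longrightarrow> f \<cdot> \<zero> Y Z = \<zero> X Z"
    and tensor_add_left:
      "f \<in> Hom X Y \<Longrightarrow> g \<in> Hom X Y \<Longrightarrow> h \<in> Hom X' Y' \<Longrightarrow> (f \<oplus> g) \<otimes> h = f \<otimes> h \<oplus> g \<otimes> h"
    and tensor_add_right:
      "f \<in> Hom X' Y' \<Longrightarrow> g \<in> Hom X Y \<Longrightarrow> h \<in> Hom X Y \<Longrightarrow> f \<otimes> (g \<oplus> h) = f \<otimes> g \<oplus> f \<otimes> h"
    and tensor_zero_left: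
      "X \<in> Ob C \<Longrightarrow> Y \<in> Ob C \<Longrightarrow> f \<in> Hom X' Y' \<Longrightarrow>
        \<zero> X Y \<otimes> f = \<zero> (X \<otimes>\<^sub>o X') (Y \<otimes>\<^sub>o Y')"
    and tensor_zero_right:
      "f \<in> Hom X' Y' \<Longrightarrow> X \<in> Ob C \<Longrightarrow> Y \<in> Ob C \<Longrightarrow>
        f \<otimes> \<zero> X Y = \<zero> (X' \<otimes>\<^sub>o X) (Y' \<otimes>\<^sub>o Y)"

(* Fo, Fa and Go, Ga are the object and arrow parts of two endofunctors of C. *)
definition natural ::
    "('o, 'm, 'z) cat_scheme \<Rightarrow> ('o \<Rightarrow> 'o) \<Rightarrow> ('m \<Rightarrow> 'm) \<Rightarrow> ('o \<Rightarrow> 'o) \<Rightarrow> ('m \<Rightarrow> 'm) \<Rightarrow>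
      ('o \<Rightarrow> 'm) \<Rightarrow> bool" where
  "natural C Fo Fa Go Ga t \<longleftrightarrow>
    (\<forall>X \<in> Ob C. t X \<in> Hom\<^bsub>C\<^esub> (Fo X) (Go X)) \<and>
    (\<forall>X Y. \<forall>f \<in> Hom\<^bsub>C\<^esub> X Y. Fa f \<cdot>\<^bsub>C\<^esub> t Y = t X \<cdot>\<^bsub>C\<^esub> Ga f)"

(* Bo and Ba are the object and arrow parts of the functor ! *)
locale coalgebra_modality = symmetric_monoidal_category C
  for C :: "('o, 'm, 'z) smc_scheme" (structure) +
  fixes Bo :: "'o \<Rightarrow> 'o" and Ba :: "'m \<Rightarrow> 'm"
    and \<delta> \<epsilon> \<Delta> e :: "'o \<Rightarrow> 'm"
  assumes bang_ob: "X \<in> Ob C \<Longrightarrow> Bo X \<in> Ob C"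
    and bang_hom: "f \<in> Hom X Y \<Longrightarrow> Ba f \<in> Hom (Bo X) (Bo Y)"
    and bang_id: "X \<in> Ob C \<Longrightarrow> Ba (\<one> X) = \<one> (Bo X)"
    and bang_comp: "f \<in> Hom X Y \<Longrightarrow> g \<in> Hom Y Z \<Longrightarrow> Ba (f \<cdot> g) = Ba f \<cdot> Ba g"
    and delta_natural: "natural C Bo Ba (\<lambda>X. Bo (Bo X)) (\<lambda>f. Ba (Ba f)) \<delta>"
    and epsilon_natural: "natural C Bo Ba (\<lambda>X. X) (\<lambda>f. f) \<epsilon>"
    and comonad_counit_left: "X \<in> Ob C \<Longrightarrow> \<delta> X \<cdot> \<epsilon> (Bo X) = \<one> (Bo X)"
    and comonad_counit_right: "X \<in> Ob C \<Longrightarrow> \<delta> X \<cdot> Ba (\<epsilon> X) = \<one> (Bo X)"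
    and comonad_coassoc: "X \<in> Ob C \<Longrightarrow> \<delta> X \<cdot> \<delta> (Bo X) = \<delta> X \<cdot> Ba (\<delta> X)"
    and Delta_natural: "natural C Bo Ba (\<lambda>X. Bo X \<otimes>\<^sub>o Bo X) (\<lambda>f. Ba f \<otimes> Ba f) \<Delta>"
    and e_natural: "natural C Bo Ba (\<lambda>X. K) (\<lambda>f. \<one> K) e"
    and comult_assoc:
      "X \<in> Ob C \<Longrightarrow> \<Delta> X \<cdot> (\<Delta> X \<otimes> \<one> (Bo X)) = \<Delta> X \<cdot> (\<one> (Bo X) \<otimes> \<Delta> X)"
    and comult_counit_left: "X \<in> Ob C \<Longrightarrow> \<Delta> X \<cdot> (e X \<otimes> \<one> (Bo X)) = \<one> (Bo X)"
    and comult_counit_right: "X \<in> Ob C \<Longrightarrow> \<Delta> X \<cdot> (\<one> (Bo X) \<otimes> e X) = \<one> (Bo X)"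
    and comult_commute: "X \<in> Ob C \<Longrightarrow> \<Delta> X \<cdot> \<sigma> (Bo X) (Bo X) = \<Delta> X"
    and delta_Delta: "X \<in> Ob C \<Longrightarrow> \<delta> X \<cdot> \<Delta> (Bo X) = \<Delta> X \<cdot> (\<delta> X \<otimes> \<delta> X)"

locale bialgebra_modality =
  additive_symmetric_monoidal_category C + coalgebra_modality C Bo Ba \<delta> \<epsilon> \<Delta> e
  for C :: "('o, 'm, 'z) asmc_scheme" (structure)
    and Bo :: "'o \<Rightarrow> 'o" and Ba :: "'m \<Rightarrow> 'm"
    and \<delta> \<epsilon> \<Delta> e :: "'o \<Rightarrow> 'm" +
  fixes nabla u :: "'o \<Rightarrow> 'm"
  assumes nabla_natural: "natural C (\<lambda>X. Bo X \<otimes>\<^sub>o Bo X) (\<lambda>f. Ba f \<otimes> Ba f) Bo Ba nabla"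
    and u_natural: "natural C (\<lambda>X. K) (\<lambda>f. \<one> K) Bo Ba u"
    and mult_assoc:
      "X \<in> Ob C \<Longrightarrow> (nabla X \<otimes> \<one> (Bo X)) \<cdot> nabla X = (\<one> (Bo X) \<otimes> nabla X) \<cdot> nabla X"
    and mult_unit_left: "X \<in> Ob C \<Longrightarrow> (u X \<otimes> \<one> (Bo X)) \<cdot> nabla X = \<one> (Bo X)"
    and mult_unit_right: "X \<in> Ob C \<Longrightarrow> (\<one> (Bo X) \<otimes> u X) \<cdot> nabla X = \<one> (Bo X)"
    and mult_commute: "X \<in> Ob C \<Longrightarrow> \<sigma> (Bo X) (Bo X) \<cdot> nabla X = nabla X"
    and nabla_e: "X \<in> Ob C \<Longrightarrow> nabla X \<cdot> e X = e X \<otimes> e X"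
    and u_Delta: "X \<in> Ob C \<Longrightarrow> u X \<cdot> \<Delta> X = u X \<otimes> u X"
    and u_e: "X \<in> Ob C \<Longrightarrow> u X \<cdot> e X = \<one> K"
    and nabla_Delta:
      "X \<in> Ob C \<Longrightarrow> nabla X \<cdot> \<Delta> X =
        (\<Delta> X \<otimes> \<Delta> X) \<cdot> (\<one> (Bo X) \<otimes> \<sigma> (Bo X) (Bo X) \<otimes> \<one> (Bo X)) \<cdot> (nabla X \<otimes> nabla X)"
    and nabla_epsilon: "X \<in> Ob C \<Longrightarrow> nabla X \<cdot> \<epsilon> X = \<epsilon> X \<otimes> e X \<oplus> e X \<otimes> \<epsilon> X"

locale additive_bialgebra_modality = bialgebra_modality +
  assumes bang_add:
      "f \<in> Hom X Y \<Longrightarrow> g \<in> Hom X Y \<Longrightarrow> Ba (f \<oplus> g) = \<Delta> X \<cdot> (Ba f \<otimes> Ba g) \<cdot> nabla Y"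
    and bang_zero: "X \<in> Ob C \<Longrightarrow> Y \<in> Ob C \<Longrightarrow> Ba (\<zero> X Y) = e X \<cdot> u Y"

end

theory Submission
  imports Defs
begin

text \<open>
  Put \<open>\<eta> = (u \<otimes> 1) d : A \<rightarrow> !A\<close>. The linear rule gives \<open>\<eta> \<epsilon> = 1\<close> and naturality gives \<open>\<eta> e = 0\<close>.
  Hence with \<open>X = !A \<otimes> !A\<close> the maps \<open>i\<^sub>0 = \<eta> \<otimes> u\<close>, \<open>i\<^sub>1 = u \<otimes> \<eta>\<close> and \<open>p\<^sub>0 = \<epsilon> \<otimes> e\<close>, \<open>p\<^sub>1 = e \<otimes> \<epsilon>\<close> satisfy
  \<open>i\<^sub>0 p\<^sub>0 = i\<^sub>1 p\<^sub>1 = 1\<close>, \<open>i\<^sub>0 p\<^sub>1 = i\<^sub>1 p\<^sub>0 = 0\<close>, and additivity of the modality makes \<open>!A \<otimes> !A\<close> a retract of \<open>!X\<close> via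
  \<open>\<theta> = (!i\<^sub>0 \<otimes> !i\<^sub>1) \<nabla>\<close> and \<open>\<psi> = \<Delta> (!p\<^sub>0 \<otimes> !p\<^sub>1)\<close>, with \<open>\<Delta> \<theta> = !(i\<^sub>0 + i\<^sub>1)\<close> and \<open>\<psi> \<nabla> = !(p\<^sub>0 + p\<^sub>1)\<close>.

  Naturality of \<open>\<eta>\<close> at \<open>i\<^sub>0 + i\<^sub>1\<close> then yields \<open>\<eta> \<Delta> = (i\<^sub>0 + i\<^sub>1) \<eta> \<psi> = \<eta> \<otimes> u + u \<otimes> \<eta>\<close>. The
  \<open>\<nabla>\<close>-rule says \<open>d = (1 \<otimes> \<eta>) \<nabla>\<close>, so the Leibniz rule follows from the bialgebra law. Conversely,
  \<open>\<nabla> = \<theta> !(p\<^sub>0 + p\<^sub>1)\<close> and \<open>i\<^sub>1 (p\<^sub>0 + p\<^sub>1) = 1\<close>, so naturality of \<open>d\<close> gives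
  \<open>(\<nabla> \<otimes> 1) d = (\<theta> \<otimes> i\<^sub>1) d \<psi> \<nabla>\<close>; the Leibniz rule at \<open>X\<close> splits this into \<open>(1 \<otimes> d) \<nabla>\<close> and a
  term containing \<open>i\<^sub>1 p\<^sub>0 = 0\<close>.
\<close>

section \<open>Arrow calculus via domains and codomains\<close>

lemma Hom_iff: "f \<in> Hom\<^bsub>C\<^esub> X Y \<longleftrightarrow> f \<in> Ar C \<and> Dom C f = X \<and> Cod C f = Y"
  by (auto simp: Hom_def)

context category
begin

lemma ident_simps [simp]:
  assumes "X \<in> Ob C"
  shows "\<one> X \<in> Ar C" "Dom C (\<one> X) = X" "Cod C (\<one> X) = X"
  using id_hom[OF assms] by (auto simp: Hom_iff)

text \<open>Hom-set hypotheses mention intermediate objects that do not occur in the conclusion.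
  Phrased with \<open>Dom\<close> and \<open>Cod\<close>, as here and in the variants ending in
  \<open>_ar\<close>, typing becomes a computation.\<close>

lemma comp_simps [simp]:
  assumes "f \<in> Ar C" "g \<in> Ar C" "Cod C f = Dom C g"
  shows "f \<cdot> g \<in> Ar C" "Dom C (f \<cdot> g) = Dom C f" "Cod C (f \<cdot> g) = Cod C g"
  using comp_hom[of f "Dom C f" "Cod C f" g "Cod C g"] assms by (auto simp: Hom_iff)

lemma Dom_ob [simp]: "f \<in> Ar C \<Longrightarrow> Dom C f \<in> Ob C"
  by (rule dom_ob)

lemma Cod_ob [simp]: "f \<in> Ar C \<Longrightarrow> Cod C f \<in> Ob C"
  by (rule cod_ob)

lemma id_comp_ar [simp]: "f \<in> Ar C \<Longrightarrow> Dom C f = X \<Longrightarrow> \<one> X \<cdot> f = f"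
  by (rule id_comp) (auto simp: Hom_iff)

lemma comp_id_ar [simp]: "f \<in> Ar C \<Longrightarrow> Cod C f = Y \<Longrightarrow> f \<cdot> \<one> Y = f"
  by (rule comp_id) (auto simp: Hom_iff)

lemma comp_assoc_ar:
  assumes "f \<in> Ar C" "g \<in> Ar C" "h \<in> Ar C" "Cod C f = Dom C g" "Cod C g = Dom C h"
  shows "(f \<cdot> g) \<cdot> h = f \<cdot> (g \<cdot> h)"
  using comp_assoc[of f "Dom C f" "Cod C f" g "Cod C g" h "Cod C h"] assms
  by (auto simp: Hom_iff)

end

section \<open>Strict symmetric monoidal structure\<close>

context symmetric_monoidal_category
begin

declare unit_ob [simp] tensor_ob [simp] tensor_ob_assoc [simp]
  tensor_ob_unit_left [simp] tensor_ob_unit_right [simp] tensor_id [simp]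
  tensor_unit_left [simp] tensor_unit_right [simp]

lemma tensor_simps [simp]:
  assumes "f \<in> Ar C" "g \<in> Ar C"
  shows "f \<otimes> g \<in> Ar C" "Dom C (f \<otimes> g) = Dom C f \<otimes>\<^sub>o Dom C g"
    "Cod C (f \<otimes> g) = Cod C f \<otimes>\<^sub>o Cod C g"
  using tensor_hom[of f "Dom C f" "Cod C f" g "Dom C g" "Cod C g"] assms
  by (auto simp: Hom_iff)

lemma symm_simps [simp]:
  assumes "X \<in> Ob C" "Y \<in> Ob C"
  shows "\<sigma> X Y \<in> Ar C" "Dom C (\<sigma> X Y) = X \<otimes>\<^sub>o Y" "Cod C (\<sigma> X Y) = Y \<otimes>\<^sub>o X"
  using symm_hom[OF assms] by (auto simp: Hom_iff)

lemma interchange: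
  assumes "f \<in> Ar C" "g \<in> Ar C" "f' \<in> Ar C" "g' \<in> Ar C"
    "Cod C f = Dom C g" "Cod C f' = Dom C g'"
  shows "(f \<otimes> f') \<cdot> (g \<otimes> g') = (f \<cdot> g) \<otimes> (f' \<cdot> g')"
  using tensor_comp[of f "Dom C f" "Cod C f" g "Cod C g" f' "Dom C f'" "Cod C f'" g' "Cod C g'"]
    assms by (auto simp: Hom_iff)

lemma symm_natural_ar:
  assumes "f \<in> Ar C" "g \<in> Ar C" "Cod C f = Y" "Cod C g = Y'"
  shows "(f \<otimes> g) \<cdot> \<sigma> Y Y' = \<sigma> (Dom C f) (Dom C g) \<cdot> (g \<otimes> f)"
  using symm_natural[of f "Dom C f" Y g "Dom C g" Y'] assms by (auto simp: Hom_iff)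

text \<open>The hexagon at \<open>Y = Z = K\<close> makes this map idempotent, and an invertible
  idempotent is an identity. With it, naturality lets a symmetry disappear next to
  \<open>u\<close>.\<close>

lemma symm_unit_right [simp]:
  assumes "X \<in> Ob C" shows "\<sigma> X K = \<one> X"
proof -
  have s: "\<sigma> X K \<cdot> \<sigma> X K = \<sigma> X K"
    using symm_hexagon[of X K K] assms by simp
  have "\<sigma> X K = (\<sigma> X K \<cdot> \<sigma> X K) \<cdot> \<sigma> K X"
    using assms symm_symm[of X K] by (simp add: comp_assoc_ar)
  also have "\<dots> = \<one> X"
    using s symm_symm[of X K] assms by simp
  finally show ?thesis .
qed

end

section \<open>Sums and zero maps\<close>

context additive_symmetric_monoidal_category
begin

lemma zero_simps [simp]:
  assumes "X \<in> Ob C" "Y \<in> Ob C"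
  shows "\<zero> X Y \<in> Ar C" "Dom C (\<zero> X Y) = X" "Cod C (\<zero> X Y) = Y"
  using zero_hom[OF assms] by (auto simp: Hom_iff)

lemma add_simps [simp]:
  assumes "f \<in> Ar C" "g \<in> Ar C" "Dom C f = Dom C g" "Cod C f = Cod C g"
  shows "f \<oplus> g \<in> Ar C" "Dom C (f \<oplus> g) = Dom C g" "Cod C (f \<oplus> g) = Cod C g"
  using add_hom[of f "Dom C f" "Cod C f" g] assms by (auto simp: Hom_iff)

lemma add_zero_ar [simp]:
  assumes "f \<in> Ar C" "Dom C f = X" "Cod C f = Y"
  shows "\<zero> X Y \<oplus> f = f" "f \<oplus> \<zero> X Y = f"
  using zero_add[of f X Y] add_commute[of f X Y "\<zero> X Y"] assms zero_hom[of X Y]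
  by (auto simp: Hom_iff)

lemma comp_zero_ar [simp]:
  assumes "f \<in> Ar C" "X \<in> Ob C"
  shows "Dom C f = Y \<Longrightarrow> \<zero> X Y \<cdot> f = \<zero> X (Cod C f)"
    "Cod C f = Y \<Longrightarrow> f \<cdot> \<zero> Y X = \<zero> (Dom C f) X"
  using comp_zero_left[of X f Y "Cod C f"] comp_zero_right[of f "Dom C f" Y X] assms
  by (auto simp: Hom_iff)

lemma tensor_zero_ar [simp]:
  assumes "f \<in> Ar C" "X \<in> Ob C" "Y \<in> Ob C"
  shows "\<zero> X Y \<otimes> f = \<zero> (X \<otimes>\<^sub>o Dom C f) (Y \<otimes>\<^sub>o Cod C f)"
    "f \<otimes> \<zero> X Y = \<zero> (Dom C f \<otimes>\<^sub>o X) (Cod C f \<otimes>\<^sub>o Y)"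
  using tensor_zero_left[of X Y f "Dom C f" "Cod C f"] tensor_zero_right[of f "Dom C f" "Cod C f" X Y]
    assms by (auto simp: Hom_iff)

lemma comp_add_left_ar:
  assumes "f \<in> Ar C" "g \<in> Ar C" "h \<in> Ar C" "Dom C f = Dom C g" "Cod C f = Dom C h" "Cod C g = Dom C h"
  shows "(f \<oplus> g) \<cdot> h = f \<cdot> h \<oplus> g \<cdot> h"
  using comp_add_left[of f "Dom C f" "Cod C f" g h "Cod C h"] assms by (auto simp: Hom_iff)

lemma comp_add_right_ar:
  assumes "f \<in> Ar C" "g \<in> Ar C" "h \<in> Ar C" "Cod C f = Dom C g" "Cod C f = Dom C h" "Cod C g = Cod C h"
  shows "f \<cdot> (g \<oplus> h) = f \<cdot> g \<oplus> f \<cdot> h"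
  using comp_add_right[of f "Dom C f" "Cod C f" g "Cod C g" h] assms by (auto simp: Hom_iff)

lemma tensor_add_right_ar:
  assumes "f \<in> Ar C" "g \<in> Ar C" "h \<in> Ar C" "Dom C g = Dom C h" "Cod C g = Cod C h"
  shows "f \<otimes> (g \<oplus> h) = f \<otimes> g \<oplus> f \<otimes> h"
  using tensor_add_right[of f "Dom C f" "Cod C f" g "Dom C g" "Cod C g" h] assms
  by (auto simp: Hom_iff)

end

section \<open>Coalgebra and bialgebra modalities\<close>

context coalgebra_modality
begin

declare bang_ob [simp]

lemma bang_simps [simp]:
  assumes "f \<in> Ar C"
  shows "Ba f \<in> Ar C" "Dom C (Ba f) = Bo (Dom C f)" "Cod C (Ba f) = Bo (Cod C f)"
  using bang_hom[of f "Dom C f" "Cod C f"] assms by (auto simp: Hom_iff)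

lemma bang_comp_ar:
  assumes "f \<in> Ar C" "g \<in> Ar C" "Cod C f = Dom C g"
  shows "Ba f \<cdot> Ba g = Ba (f \<cdot> g)"
  using bang_comp[of f "Dom C f" "Cod C f" g "Cod C g"] assms by (auto simp: Hom_iff)

lemma epsilon_simps [simp]:
  assumes "X \<in> Ob C"
  shows "\<epsilon> X \<in> Ar C" "Dom C (\<epsilon> X) = Bo X" "Cod C (\<epsilon> X) = X"
  using epsilon_natural assms by (auto simp: natural_def Hom_iff)

lemma Delta_simps [simp]:
  assumes "X \<in> Ob C"
  shows "\<Delta> X \<in> Ar C" "Dom C (\<Delta> X) = Bo X" "Cod C (\<Delta> X) = Bo X \<otimes>\<^sub>o Bo X"
  using Delta_natural assms by (auto simp: natural_def Hom_iff)

lemma e_simps [simp]: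
  assumes "X \<in> Ob C"
  shows "e X \<in> Ar C" "Dom C (e X) = Bo X" "Cod C (e X) = K"
  using e_natural assms by (auto simp: natural_def Hom_iff)

lemma bang_epsilon: "f \<in> Hom X Y \<Longrightarrow> Ba f \<cdot> \<epsilon> Y = \<epsilon> X \<cdot> f"
  using epsilon_natural by (auto simp: natural_def)

lemma bang_Delta: "f \<in> Hom X Y \<Longrightarrow> Ba f \<cdot> \<Delta> Y = \<Delta> X \<cdot> (Ba f \<otimes> Ba f)"
  using Delta_natural by (auto simp: natural_def)

lemma bang_e: "f \<in> Hom X Y \<Longrightarrow> Ba f \<cdot> e Y = e X"
  using e_natural unfolding natural_def
  by (metis Hom_iff comp_id dom_ob)

end

context bialgebra_modality
begin

lemma nabla_simps [simp]:
  assumes "X \<in> Ob C"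
  shows "nabla X \<in> Ar C" "Dom C (nabla X) = Bo X \<otimes>\<^sub>o Bo X" "Cod C (nabla X) = Bo X"
  using nabla_natural assms by (auto simp: natural_def Hom_iff)

lemma u_simps [simp]:
  assumes "X \<in> Ob C"
  shows "u X \<in> Ar C" "Dom C (u X) = K" "Cod C (u X) = Bo X"
  using u_natural assms by (auto simp: natural_def Hom_iff)

lemma nabla_bang: "f \<in> Hom X Y \<Longrightarrow> (Ba f \<otimes> Ba f) \<cdot> nabla Y = nabla X \<cdot> Ba f"
  using nabla_natural by (auto simp: natural_def)

lemma u_bang: "f \<in> Hom X Y \<Longrightarrow> u X \<cdot> Ba f = u Y"
  using u_natural unfolding natural_def
  by (metis Hom_iff id_comp cod_ob)

end

section \<open>Consequences of additivity of the modality\<close>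

context additive_bialgebra_modality
begin

text \<open>Naturality of \<open>u\<close> inserts \<open>Ba (\<zero> X X)\<close>, and naturality
  of \<open>\<epsilon>\<close> then turns it into a plain zero factor.\<close>

lemma u_epsilon:
  assumes "X \<in> Ob C" shows "u X \<cdot> \<epsilon> X = \<zero> K X"
proof -
  have z: "\<zero> X X \<in> Hom X X" using assms by (simp add: zero_hom)
  have "u X \<cdot> \<epsilon> X = u X \<cdot> (Ba (\<zero> X X) \<cdot> \<epsilon> X)"
    using u_bang[OF z] assms by (simp flip: comp_assoc_ar)
  also have "\<dots> = \<zero> K X"
    using assms by (simp add: bang_epsilon[OF z])
  finally show ?thesis .
qed

text \<open>The cross terms \<open>!(i\<^sub>0 p\<^sub>1) = !(i\<^sub>1 p\<^sub>0) = !0 = e u\<close> are absorbed by the unit and counit laws.\<close>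

lemma retract_bang:
  assumes i: "i\<^sub>0 \<in> Hom A X" "i\<^sub>1 \<in> Hom A X" and p: "p\<^sub>0 \<in> Hom X A" "p\<^sub>1 \<in> Hom X A"
    and ip: "i\<^sub>0 \<cdot> p\<^sub>0 = \<one> A" "i\<^sub>1 \<cdot> p\<^sub>1 = \<one> A" "i\<^sub>0 \<cdot> p\<^sub>1 = \<zero> A A" "i\<^sub>1 \<cdot> p\<^sub>0 = \<zero> A A"
  shows "(Ba i\<^sub>0 \<otimes> Ba i\<^sub>1) \<cdot> nabla X \<cdot> \<Delta> X \<cdot> (Ba p\<^sub>0 \<otimes> Ba p\<^sub>1) = \<one> (Bo A \<otimes>\<^sub>o Bo A)"
proof -
  have [simp]: "i\<^sub>0 \<in> Ar C" "Dom C i\<^sub>0 = A" "Cod C i\<^sub>0 = X" "i\<^sub>1 \<in> Ar C" "Dom C i\<^sub>1 = A" "Cod C i\<^sub>1 = X"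
    "p\<^sub>0 \<in> Ar C" "Dom C p\<^sub>0 = X" "Cod C p\<^sub>0 = A" "p\<^sub>1 \<in> Ar C" "Dom C p\<^sub>1 = X" "Cod C p\<^sub>1 = A"
    using i p by (auto simp: Hom_iff)
  have ob [simp]: "A \<in> Ob C" "X \<in> Ob C"
    using Dom_ob[of i\<^sub>0] Cod_ob[of i\<^sub>0] by simp_all
  let ?A = "Bo A" and ?X = "Bo X"
  let ?s = "\<one> ?X \<otimes> \<sigma> ?X ?X \<otimes> \<one> ?X"
  have bb: "Ba i\<^sub>0 \<cdot> Ba p\<^sub>0 = \<one> ?A" "Ba i\<^sub>1 \<cdot> Ba p\<^sub>1 = \<one> ?A"
    "Ba i\<^sub>0 \<cdot> Ba p\<^sub>1 = e A \<cdot> u A" "Ba i\<^sub>1 \<cdot> Ba p\<^sub>0 = e A \<cdot> u A"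
    by (simp_all add: bang_comp_ar ip bang_id bang_zero)
  \<comment> \<open>The symmetry pairs each injection with the wrong projection. It then slides in
    front of \<open>u A \<otimes> u A\<close>, where it becomes \<open>\<sigma> K K\<close>, an
    identity.\<close>
  have cross: "(Ba i\<^sub>0 \<otimes> Ba i\<^sub>1) \<cdot> (\<sigma> ?X ?X \<cdot> (Ba p\<^sub>0 \<otimes> Ba p\<^sub>1)) = (e A \<cdot> u A) \<otimes> (e A \<cdot> u A)"
  proof -
    have "(Ba i\<^sub>0 \<otimes> Ba i\<^sub>1) \<cdot> (\<sigma> ?X ?X \<cdot> (Ba p\<^sub>0 \<otimes> Ba p\<^sub>1))
        = (Ba i\<^sub>0 \<otimes> Ba i\<^sub>1) \<cdot> ((Ba p\<^sub>1 \<otimes> Ba p\<^sub>0) \<cdot> \<sigma> ?A ?A)"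
      using symm_natural_ar[of "Ba p\<^sub>1" "Ba p\<^sub>0"] by simp
    also have "\<dots> = ((e A \<cdot> u A) \<otimes> (e A \<cdot> u A)) \<cdot> \<sigma> ?A ?A"
      by (simp add: interchange bb flip: comp_assoc_ar)
    also have "\<dots> = (e A \<otimes> e A) \<cdot> ((u A \<otimes> u A) \<cdot> \<sigma> ?A ?A)"
      by (simp add: comp_assoc_ar flip: interchange)
    also have "\<dots> = (e A \<cdot> u A) \<otimes> (e A \<cdot> u A)"
      by (simp add: symm_natural_ar interchange)
    finally show ?thesis .
  qed
  have "(Ba i\<^sub>0 \<otimes> Ba i\<^sub>1) \<cdot> nabla X \<cdot> \<Delta> X \<cdot> (Ba p\<^sub>0 \<otimes> Ba p\<^sub>1)
      = (Ba i\<^sub>0 \<otimes> Ba i\<^sub>1) \<cdot> (nabla X \<cdot> \<Delta> X) \<cdot> (Ba p\<^sub>0 \<otimes> Ba p\<^sub>1)"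
    by (simp add: comp_assoc_ar)
  also have "\<dots> = ((Ba i\<^sub>0 \<otimes> Ba i\<^sub>1) \<cdot> (\<Delta> X \<otimes> \<Delta> X)) \<cdot> ?s \<cdot> ((nabla X \<otimes> nabla X) \<cdot> (Ba p\<^sub>0 \<otimes> Ba p\<^sub>1))"
    by (simp add: nabla_Delta comp_assoc_ar)
  \<comment> \<open>Naturality moves \<open>\<Delta>\<close> in front of the injections and, dually,
    \<open>nabla\<close> behind the projections, so the four strands in between can be evaluated
    separately.\<close>
  also have "(Ba i\<^sub>0 \<otimes> Ba i\<^sub>1) \<cdot> (\<Delta> X \<otimes> \<Delta> X)
      = (\<Delta> A \<otimes> \<Delta> A) \<cdot> (Ba i\<^sub>0 \<otimes> (Ba i\<^sub>0 \<otimes> Ba i\<^sub>1) \<otimes> Ba i\<^sub>1)"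
  proof -
    have "(Ba i\<^sub>0 \<otimes> Ba i\<^sub>1) \<cdot> (\<Delta> X \<otimes> \<Delta> X)
        = (\<Delta> A \<otimes> \<Delta> A) \<cdot> ((Ba i\<^sub>0 \<otimes> Ba i\<^sub>0) \<otimes> (Ba i\<^sub>1 \<otimes> Ba i\<^sub>1))"
      by (simp add: interchange bang_Delta[OF i(1)] bang_Delta[OF i(2)])
    then show ?thesis by (simp add: tensor_assoc)
  qed
  also have "(nabla X \<otimes> nabla X) \<cdot> (Ba p\<^sub>0 \<otimes> Ba p\<^sub>1)
      = (Ba p\<^sub>0 \<otimes> (Ba p\<^sub>0 \<otimes> Ba p\<^sub>1) \<otimes> Ba p\<^sub>1) \<cdot> (nabla A \<otimes> nabla A)"
  proof -
    have "(nabla X \<otimes> nabla X) \<cdot> (Ba p\<^sub>0 \<otimes> Ba p\<^sub>1)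
        = ((Ba p\<^sub>0 \<otimes> Ba p\<^sub>0) \<otimes> (Ba p\<^sub>1 \<otimes> Ba p\<^sub>1)) \<cdot> (nabla A \<otimes> nabla A)"
      by (simp add: interchange nabla_bang[OF p(1)] nabla_bang[OF p(2)])
    then show ?thesis by (simp add: tensor_assoc)
  qed
  also have "((\<Delta> A \<otimes> \<Delta> A) \<cdot> (Ba i\<^sub>0 \<otimes> (Ba i\<^sub>0 \<otimes> Ba i\<^sub>1) \<otimes> Ba i\<^sub>1)) \<cdot> ?s
        \<cdot> ((Ba p\<^sub>0 \<otimes> (Ba p\<^sub>0 \<otimes> Ba p\<^sub>1) \<otimes> Ba p\<^sub>1) \<cdot> (nabla A \<otimes> nabla A))
      = (\<Delta> A \<otimes> \<Delta> A) \<cdot> ((Ba i\<^sub>0 \<otimes> (Ba i\<^sub>0 \<otimes> Ba i\<^sub>1) \<otimes> Ba i\<^sub>1) \<cdot> (?s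
        \<cdot> (Ba p\<^sub>0 \<otimes> (Ba p\<^sub>0 \<otimes> Ba p\<^sub>1) \<otimes> Ba p\<^sub>1))) \<cdot> (nabla A \<otimes> nabla A)"
    by (simp add: comp_assoc_ar)
  \<comment> \<open>The outer strands meet matching pairs and become identities; the two inner ones
    are given by \<open>cross\<close>.\<close>
  also have "(Ba i\<^sub>0 \<otimes> (Ba i\<^sub>0 \<otimes> Ba i\<^sub>1) \<otimes> Ba i\<^sub>1) \<cdot> (?s
        \<cdot> (Ba p\<^sub>0 \<otimes> (Ba p\<^sub>0 \<otimes> Ba p\<^sub>1) \<otimes> Ba p\<^sub>1))
      = \<one> ?A \<otimes> ((e A \<cdot> u A) \<otimes> (e A \<cdot> u A)) \<otimes> \<one> ?A"
  proof -
    have "?s \<cdot> (Ba p\<^sub>0 \<otimes> (Ba p\<^sub>0 \<otimes> Ba p\<^sub>1) \<otimes> Ba p\<^sub>1)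
        = Ba p\<^sub>0 \<otimes> (\<sigma> ?X ?X \<cdot> (Ba p\<^sub>0 \<otimes> Ba p\<^sub>1)) \<otimes> Ba p\<^sub>1"
      by (simp add: interchange)
    then show ?thesis by (simp add: interchange cross bb)
  qed
  \<comment> \<open>Regrouped by halves, each \<open>e A\<close> cancels against a
    \<open>\<Delta> A\<close> and each \<open>u A\<close> against a \<open>nabla A\<close>.\<close>
  also have "\<dots> = (\<one> ?A \<otimes> (e A \<cdot> u A)) \<otimes> ((e A \<cdot> u A) \<otimes> \<one> ?A)"
    by (simp add: tensor_assoc)
  also have "\<dots> = ((\<one> ?A \<otimes> e A) \<otimes> (e A \<otimes> \<one> ?A)) \<cdot> ((\<one> ?A \<otimes> u A) \<otimes> (u A \<otimes> \<one> ?A))"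
    by (simp add: interchange del: tensor_unit_left tensor_unit_right)
  also have "(\<Delta> A \<otimes> \<Delta> A) \<cdot> \<dots> \<cdot> (nabla A \<otimes> nabla A)
      = ((\<Delta> A \<otimes> \<Delta> A) \<cdot> ((\<one> ?A \<otimes> e A) \<otimes> (e A \<otimes> \<one> ?A)))
        \<cdot> (((\<one> ?A \<otimes> u A) \<otimes> (u A \<otimes> \<one> ?A)) \<cdot> (nabla A \<otimes> nabla A))"
    by (simp add: comp_assoc_ar)
  also have "\<dots> = \<one> (?A \<otimes>\<^sub>o ?A)"
    by (simp add: interchange comult_counit_left comult_counit_right mult_unit_left mult_unit_right)
  finally show ?thesis .
qed

end

section \<open>The codereliction attached to \<open>d\<close>\<close>

locale linear_rule_transformation = additive_bialgebra_modality C Bo Ba \<delta> \<epsilon> \<Delta> e nabla u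
  for C :: "('o, 'm, 'z) asmc_scheme" (structure)
    and Bo :: "'o \<Rightarrow> 'o" and Ba :: "'m \<Rightarrow> 'm"
    and \<delta> \<epsilon> \<Delta> e nabla u :: "'o \<Rightarrow> 'm" +
  fixes d :: "'o \<Rightarrow> 'm"
  assumes d_natural: "natural C (\<lambda>X. Bo X \<otimes>\<^sub>o X) (\<lambda>f. Ba f \<otimes> f) Bo Ba d"
    and linear_rule: "\<And>X. X \<in> Ob C \<Longrightarrow> d X \<cdot> \<epsilon> X = e X \<otimes> \<one> X"
begin

lemma d_simps [simp]:
  assumes "X \<in> Ob C"
  shows "d X \<in> Ar C" "Dom C (d X) = Bo X \<otimes>\<^sub>o X" "Cod C (d X) = Bo X"
  using d_natural assms by (auto simp: natural_def Hom_iff)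

lemma d_bang: "f \<in> Hom X Y \<Longrightarrow> (Ba f \<otimes> f) \<cdot> d Y = d X \<cdot> Ba f"
  using d_natural by (auto simp: natural_def)

text \<open>The codereliction of differential linear logic: the derivative at the base point
  \<open>u\<close>.\<close>

definition \<eta> :: "'o \<Rightarrow> 'm" where
  "\<eta> X = (u X \<otimes> \<one> X) \<cdot> d X"

lemma eta_simps [simp]:
  assumes "X \<in> Ob C"
  shows "\<eta> X \<in> Ar C" "Dom C (\<eta> X) = X" "Cod C (\<eta> X) = Bo X"
  using assms by (auto simp: \<eta>_def)

lemma eta_bang:
  assumes f: "f \<in> Hom X Y" shows "\<eta> X \<cdot> Ba f = f \<cdot> \<eta> Y"
proof -
  have [simp]: "f \<in> Ar C" "Dom C f = X" "Cod C f = Y" "X \<in> Ob C" "Y \<in> Ob C"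
    using f dom_ob cod_ob by (auto simp: Hom_iff)
  have "\<eta> X \<cdot> Ba f = (u X \<otimes> \<one> X) \<cdot> ((Ba f \<otimes> f) \<cdot> d Y)"
    by (simp add: \<eta>_def comp_assoc_ar d_bang[OF f])
  \<comment> \<open>The identities are inserted so that interchange, read backwards, splits off
    \<open>\<one> K \<otimes> f\<close>, which is \<open>f\<close> by strictness.\<close>
  also have "\<dots> = ((\<one> K \<cdot> u Y) \<otimes> (f \<cdot> \<one> Y)) \<cdot> d Y"
    by (simp add: interchange u_bang[OF f] flip: comp_assoc_ar)
  also have "\<dots> = (\<one> K \<otimes> f) \<cdot> ((u Y \<otimes> \<one> Y) \<cdot> d Y)"
    by (subst interchange[symmetric]) (simp_all add: comp_assoc_ar)
  also have "\<dots> = f \<cdot> \<eta> Y"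
    by (simp add: \<eta>_def)
  finally show ?thesis .
qed

lemma eta_epsilon:
  assumes "X \<in> Ob C" shows "\<eta> X \<cdot> \<epsilon> X = \<one> X"
proof -
  have "\<eta> X \<cdot> \<epsilon> X = (u X \<otimes> \<one> X) \<cdot> (e X \<otimes> \<one> X)"
    using assms by (simp add: \<eta>_def comp_assoc_ar linear_rule)
  also have "\<dots> = \<one> X"
    using assms by (simp add: interchange u_e)
  finally show ?thesis .
qed

text \<open>Naturality of \<open>e\<close> inserts \<open>Ba (\<zero> X X)\<close>, and naturality
  of \<open>\<eta>\<close> brings the zero to the front.\<close>

lemma eta_e:
  assumes "X \<in> Ob C" shows "\<eta> X \<cdot> e X = \<zero> X K"
proof -
  have z: "\<zero> X X \<in> Hom X X" using assms by (simp add: zero_hom)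
  have "\<eta> X \<cdot> e X = (\<eta> X \<cdot> Ba (\<zero> X X)) \<cdot> e X"
    using bang_e[OF z] assms by (simp add: comp_assoc_ar)
  also have "\<dots> = \<zero> X K"
    using assms by (simp add: eta_bang[OF z])
  finally show ?thesis .
qed

text \<open>The object \<open>!A \<otimes> !A\<close> stands in for the biproduct \<open>A \<oplus> A\<close>, which \<open>C\<close> need not have; the
  identity \<open>p\<^sub>0 i\<^sub>0 + p\<^sub>1 i\<^sub>1 = 1\<close> fails here but is never needed.\<close>

definition inj\<^sub>0 :: "'o \<Rightarrow> 'm" where "inj\<^sub>0 A = \<eta> A \<otimes> u A"
definition inj\<^sub>1 :: "'o \<Rightarrow> 'm" where "inj\<^sub>1 A = u A \<otimes> \<eta> A"
definition proj\<^sub>0 :: "'o \<Rightarrow> 'm" where "proj\<^sub>0 A = \<epsilon> A \<otimes> e A"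
definition proj\<^sub>1 :: "'o \<Rightarrow> 'm" where "proj\<^sub>1 A = e A \<otimes> \<epsilon> A"

lemma inj_proj_simps [simp]:
  assumes "A \<in> Ob C"
  shows "inj\<^sub>0 A \<in> Ar C" "Dom C (inj\<^sub>0 A) = A" "Cod C (inj\<^sub>0 A) = Bo A \<otimes>\<^sub>o Bo A"
    "inj\<^sub>1 A \<in> Ar C" "Dom C (inj\<^sub>1 A) = A" "Cod C (inj\<^sub>1 A) = Bo A \<otimes>\<^sub>o Bo A"
    "proj\<^sub>0 A \<in> Ar C" "Dom C (proj\<^sub>0 A) = Bo A \<otimes>\<^sub>o Bo A" "Cod C (proj\<^sub>0 A) = A"
    "proj\<^sub>1 A \<in> Ar C" "Dom C (proj\<^sub>1 A) = Bo A \<otimes>\<^sub>o Bo A" "Cod C (proj\<^sub>1 A) = A"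
  using assms by (auto simp: inj\<^sub>0_def inj\<^sub>1_def proj\<^sub>0_def proj\<^sub>1_def)

text \<open>Matching pairs reduce to \<open>\<eta> A \<cdot> \<epsilon> A\<close> and
  \<open>u A \<cdot> e A\<close>, both identities; mismatched ones to
  \<open>\<eta> A \<cdot> e A\<close> and \<open>u A \<cdot> \<epsilon> A\<close>, both
  zero.\<close>

lemma inj_proj:
  assumes "A \<in> Ob C"
  shows "inj\<^sub>0 A \<cdot> proj\<^sub>0 A = \<one> A" "inj\<^sub>1 A \<cdot> proj\<^sub>1 A = \<one> A"
    "inj\<^sub>0 A \<cdot> proj\<^sub>1 A = \<zero> A A" "inj\<^sub>1 A \<cdot> proj\<^sub>0 A = \<zero> A A"
  using assms by (simp_all add: inj\<^sub>0_def inj\<^sub>1_def proj\<^sub>0_def proj\<^sub>1_def interchange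
    eta_epsilon eta_e u_epsilon u_e)

lemma retract:
  assumes "A \<in> Ob C"
  defines "X \<equiv> Bo A \<otimes>\<^sub>o Bo A"
  shows "(Ba (inj\<^sub>0 A) \<otimes> Ba (inj\<^sub>1 A)) \<cdot> nabla X \<cdot> \<Delta> X \<cdot> (Ba (proj\<^sub>0 A) \<otimes> Ba (proj\<^sub>1 A)) = \<one> X"
  unfolding X_def using assms(1)
  by (intro retract_bang) (auto simp: Hom_iff inj_proj)

text \<open>Primitivity of \<open>\<eta>\<close>. Naturality carries a sum out of \<open>Ba\<close>
  to the front of \<open>\<eta>\<close>, where composition distributes over it.\<close>

lemma eta_Delta:
  assumes [simp]: "A \<in> Ob C"
  shows "\<eta> A \<cdot> \<Delta> A = \<eta> A \<otimes> u A \<oplus> u A \<otimes> \<eta> A"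
proof -
  define X where "X = Bo A \<otimes>\<^sub>o Bo A"
  have [simp]: "X \<in> Ob C" by (simp add: X_def)
  let ?i = "Ba (inj\<^sub>0 A) \<otimes> Ba (inj\<^sub>1 A)" and ?p = "Ba (proj\<^sub>0 A) \<otimes> Ba (proj\<^sub>1 A)"
  have [simp]: "Cod C (inj\<^sub>0 A) = X" "Cod C (inj\<^sub>1 A) = X" "Dom C (proj\<^sub>0 A) = X" "Dom C (proj\<^sub>1 A) = X"
    by (simp_all add: X_def)
  have i: "inj\<^sub>0 A \<in> Hom A X" "inj\<^sub>1 A \<in> Hom A X" "inj\<^sub>0 A \<oplus> inj\<^sub>1 A \<in> Hom A X"
    and p: "proj\<^sub>0 A \<in> Hom X A" "proj\<^sub>1 A \<in> Hom X A"
    by (auto simp: Hom_iff)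
  have z: "\<zero> A A \<in> Hom A A" by (simp add: zero_hom)
  \<comment> \<open>For a single summand naturality is run the other way, bringing the components of
    \<open>f\<close> under \<open>Ba\<close>.\<close>
  have part: "f \<cdot> (\<eta> X \<cdot> \<Delta> X \<cdot> ?p)
      = \<eta> A \<cdot> (\<Delta> A \<cdot> (Ba (f \<cdot> proj\<^sub>0 A) \<otimes> Ba (f \<cdot> proj\<^sub>1 A)))" if f: "f \<in> Hom A X" for f
  proof -
    have [simp]: "f \<in> Ar C" "Dom C f = A" "Cod C f = X" using f by (auto simp: Hom_iff)
    have "f \<cdot> (\<eta> X \<cdot> \<Delta> X \<cdot> ?p) = (\<eta> A \<cdot> Ba f) \<cdot> \<Delta> X \<cdot> ?p"
      by (simp add: comp_assoc_ar eta_bang[OF f])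
    also have "\<dots> = \<eta> A \<cdot> (Ba f \<cdot> \<Delta> X) \<cdot> ?p"
      by (simp add: comp_assoc_ar)
    also have "\<dots> = \<eta> A \<cdot> (\<Delta> A \<cdot> ((Ba f \<otimes> Ba f) \<cdot> ?p))"
      by (simp add: bang_Delta[OF f] comp_assoc_ar)
    finally show ?thesis by (simp add: interchange bang_comp_ar)
  qed
  have "\<eta> A \<cdot> \<Delta> A = \<eta> A \<cdot> (\<Delta> A \<cdot> (?i \<cdot> nabla X \<cdot> \<Delta> X \<cdot> ?p))"
    by (simp add: retract X_def)
  also have "\<dots> = (\<eta> A \<cdot> (\<Delta> A \<cdot> ?i \<cdot> nabla X)) \<cdot> \<Delta> X \<cdot> ?p"
    by (simp add: comp_assoc_ar)
  \<comment> \<open>By additivity \<open>\<Delta> A \<cdot> ?i \<cdot> nabla X\<close> is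
    \<open>Ba\<close> of the sum of the injections.\<close>
  also have "\<dots> = (inj\<^sub>0 A \<oplus> inj\<^sub>1 A) \<cdot> \<eta> X \<cdot> \<Delta> X \<cdot> ?p"
    using eta_bang[OF i(3)] by (simp add: bang_add[OF i(1,2)])
  also have "\<dots> = inj\<^sub>0 A \<cdot> (\<eta> X \<cdot> \<Delta> X \<cdot> ?p) \<oplus> inj\<^sub>1 A \<cdot> (\<eta> X \<cdot> \<Delta> X \<cdot> ?p)"
    by (simp add: comp_assoc_ar comp_add_left_ar)
  also have "inj\<^sub>0 A \<cdot> (\<eta> X \<cdot> \<Delta> X \<cdot> ?p) = \<eta> A \<cdot> (\<Delta> A \<cdot> (\<one> (Bo A) \<otimes> (e A \<cdot> u A)))"
    by (simp add: part[OF i(1)] inj_proj bang_id bang_zero)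
  also have "\<one> (Bo A) \<otimes> (e A \<cdot> u A) = (\<one> (Bo A) \<otimes> e A) \<cdot> (\<one> (Bo A) \<otimes> u A)"
    by (simp add: interchange)
  also have "\<eta> A \<cdot> (\<Delta> A \<cdot> \<dots>) = \<eta> A \<cdot> ((\<Delta> A \<cdot> (\<one> (Bo A) \<otimes> e A)) \<cdot> (\<one> (Bo A) \<otimes> u A))"
    by (simp add: comp_assoc_ar)
  \<comment> \<open>The factor \<open>\<one> K\<close> is kept so that interchange can merge
    \<open>\<eta> A\<close> with \<open>u A\<close>.\<close>
  also have "\<dots> = (\<eta> A \<otimes> \<one> K) \<cdot> (\<one> (Bo A) \<otimes> u A)"
    by (simp add: comult_counit_right)
  also have "\<dots> = \<eta> A \<otimes> u A"
    by (simp add: interchange del: tensor_unit_right)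
  also have "inj\<^sub>1 A \<cdot> (\<eta> X \<cdot> \<Delta> X \<cdot> ?p) = \<eta> A \<cdot> (\<Delta> A \<cdot> ((e A \<cdot> u A) \<otimes> \<one> (Bo A)))"
    by (simp add: part[OF i(2)] inj_proj bang_id bang_zero)
  also have "(e A \<cdot> u A) \<otimes> \<one> (Bo A) = (e A \<otimes> \<one> (Bo A)) \<cdot> (u A \<otimes> \<one> (Bo A))"
    by (simp add: interchange)
  also have "\<eta> A \<cdot> (\<Delta> A \<cdot> \<dots>) = \<eta> A \<cdot> ((\<Delta> A \<cdot> (e A \<otimes> \<one> (Bo A))) \<cdot> (u A \<otimes> \<one> (Bo A)))"
    by (simp add: comp_assoc_ar)
  also have "\<dots> = (\<one> K \<otimes> \<eta> A) \<cdot> (u A \<otimes> \<one> (Bo A))"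
    by (simp add: comult_counit_left)
  also have "\<dots> = u A \<otimes> \<eta> A"
    by (simp add: interchange del: tensor_unit_left)
  finally show ?thesis .
qed

section \<open>Equivalence of the Leibniz rule and the \<open>nabla\<close>-rule\<close>

abbreviation Leibniz :: "'o \<Rightarrow> bool" where
  "Leibniz X \<equiv> d X \<cdot> \<Delta> X = (\<Delta> X \<otimes> \<one> X) \<cdot>
    ((\<one> (Bo X) \<otimes> d X) \<oplus> (\<one> (Bo X) \<otimes> \<sigma> (Bo X) X) \<cdot> (d X \<otimes> \<one> (Bo X)))"

text \<open>Both rules are indexed by an object because the implications differ: one stays at
  \<open>A\<close>, the other needs \<open>Leibniz\<close> at
  \<open>Bo A \<otimes>\<^sub>o Bo A\<close>.\<close>

abbreviation nabla_rule :: "'o \<Rightarrow> bool" where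
  "nabla_rule X \<equiv> (nabla X \<otimes> \<one> X) \<cdot> d X = (\<one> (Bo X) \<otimes> d X) \<cdot> nabla X"

text \<open>Precompose the rule with \<open>u A\<close> in the second factor: the unit law leaves
  \<open>d A\<close> on one side, and \<open>\<eta> A\<close> forms on the other.\<close>

lemma d_eq_eta_nabla:
  assumes [simp]: "A \<in> Ob C" and rule: "nabla_rule A"
  shows "d A = (\<one> (Bo A) \<otimes> \<eta> A) \<cdot> nabla A"
proof -
  have "d A = (((\<one> (Bo A) \<otimes> u A) \<cdot> nabla A) \<otimes> (\<one> A \<cdot> \<one> A)) \<cdot> d A"
    by (simp add: mult_unit_right)
  also have "\<dots> = (\<one> (Bo A) \<otimes> u A \<otimes> \<one> A) \<cdot> ((nabla A \<otimes> \<one> A) \<cdot> d A)"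
    by (subst interchange[symmetric]) (simp_all add: comp_assoc_ar)
  also have "\<dots> = ((\<one> (Bo A) \<otimes> (u A \<otimes> \<one> A)) \<cdot> (\<one> (Bo A) \<otimes> d A)) \<cdot> nabla A"
    by (simp add: rule comp_assoc_ar tensor_assoc)
  also have "\<dots> = (\<one> (Bo A) \<otimes> \<eta> A) \<cdot> nabla A"
    by (simp add: interchange \<eta>_def)
  finally show ?thesis .
qed

text \<open>Differentiation is multiplication by \<open>\<eta>\<close>, so the bialgebra law sends
  the two summands of \<open>eta_Delta\<close> to the two output factors.\<close>

lemma nabla_rule_imp_Leibniz:
  assumes [simp]: "A \<in> Ob C" and rule: "nabla_rule A"
  shows "Leibniz A"
proof -
  let ?A = "Bo A"
  let ?s = "\<one> ?A \<otimes> \<sigma> ?A ?A \<otimes> \<one> ?A"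
  let ?N = "nabla A \<otimes> nabla A"
  note d = d_eq_eta_nabla[OF assms]
  have "d A \<cdot> \<Delta> A = (\<one> ?A \<otimes> \<eta> A) \<cdot> (nabla A \<cdot> \<Delta> A)"
    by (simp add: d comp_assoc_ar)
  also have "\<dots> = ((\<one> ?A \<otimes> \<eta> A) \<cdot> (\<Delta> A \<otimes> \<Delta> A)) \<cdot> (?s \<cdot> ?N)"
    by (simp add: nabla_Delta comp_assoc_ar)
  also have "(\<one> ?A \<otimes> \<eta> A) \<cdot> (\<Delta> A \<otimes> \<Delta> A)
      = (\<Delta> A \<otimes> \<one> A) \<cdot> (\<one> (?A \<otimes>\<^sub>o ?A) \<otimes> (\<eta> A \<otimes> u A \<oplus> u A \<otimes> \<eta> A))"
    by (simp add: interchange eta_Delta)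
  also have "\<dots> \<cdot> (?s \<cdot> ?N) = (\<Delta> A \<otimes> \<one> A) \<cdot>
      ((\<one> (?A \<otimes>\<^sub>o ?A) \<otimes> (\<eta> A \<otimes> u A)) \<cdot> (?s \<cdot> ?N) \<oplus> (\<one> (?A \<otimes>\<^sub>o ?A) \<otimes> (u A \<otimes> \<eta> A)) \<cdot> (?s \<cdot> ?N))"
    by (simp add: comp_assoc_ar tensor_add_right_ar comp_add_left_ar)
  \<comment> \<open>The first output is multiplied by \<open>u A\<close>, hence unchanged; the
    second by \<open>\<eta> A\<close>, hence differentiated.\<close>
  also have "(\<one> (?A \<otimes>\<^sub>o ?A) \<otimes> (u A \<otimes> \<eta> A)) \<cdot> (?s \<cdot> ?N) = \<one> ?A \<otimes> d A"
  proof -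
    have "\<one> (?A \<otimes>\<^sub>o ?A) \<otimes> (u A \<otimes> \<eta> A) = \<one> ?A \<otimes> (\<one> ?A \<otimes> u A) \<otimes> \<eta> A"
      by (simp add: tensor_assoc flip: tensor_id)
    then have "(\<one> (?A \<otimes>\<^sub>o ?A) \<otimes> (u A \<otimes> \<eta> A)) \<cdot> ?s
        = \<one> ?A \<otimes> ((\<one> ?A \<otimes> u A) \<cdot> \<sigma> ?A ?A) \<otimes> \<eta> A"
      by (simp add: interchange)
    also have "(\<one> ?A \<otimes> u A) \<cdot> \<sigma> ?A ?A = u A \<otimes> \<one> ?A"
      by (simp add: symm_natural_ar)
    also have "\<one> ?A \<otimes> (u A \<otimes> \<one> ?A) \<otimes> \<eta> A = (\<one> ?A \<otimes> u A) \<otimes> (\<one> ?A \<otimes> \<eta> A)"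
      by (simp add: tensor_assoc)
    finally have "(\<one> (?A \<otimes>\<^sub>o ?A) \<otimes> (u A \<otimes> \<eta> A)) \<cdot> (?s \<cdot> ?N)
        = ((\<one> ?A \<otimes> u A) \<otimes> (\<one> ?A \<otimes> \<eta> A)) \<cdot> ?N"
      by (simp flip: comp_assoc_ar)
    also have "\<dots> = \<one> ?A \<otimes> d A"
      by (simp add: interchange mult_unit_right flip: d)
    finally show ?thesis .
  qed
  \<comment> \<open>Here \<open>\<eta> A\<close> reaches the first output. Pulling it back through
    the symmetry leaves the \<open>\<sigma> ?A A\<close> of the Leibniz rule.\<close>
  also have "(\<one> (?A \<otimes>\<^sub>o ?A) \<otimes> (\<eta> A \<otimes> u A)) \<cdot> (?s \<cdot> ?N) = (\<one> ?A \<otimes> \<sigma> ?A A) \<cdot> (d A \<otimes> \<one> ?A)"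
  proof -
    have "\<one> (?A \<otimes>\<^sub>o ?A) \<otimes> (\<eta> A \<otimes> u A) = \<one> ?A \<otimes> (\<one> ?A \<otimes> \<eta> A) \<otimes> u A"
      by (simp add: tensor_assoc flip: tensor_id)
    then have "(\<one> (?A \<otimes>\<^sub>o ?A) \<otimes> (\<eta> A \<otimes> u A)) \<cdot> ?s
        = \<one> ?A \<otimes> ((\<one> ?A \<otimes> \<eta> A) \<cdot> \<sigma> ?A ?A) \<otimes> u A"
      by (simp add: interchange)
    also have "(\<one> ?A \<otimes> \<eta> A) \<cdot> \<sigma> ?A ?A = \<sigma> ?A A \<cdot> (\<eta> A \<otimes> \<one> ?A)"
      by (simp add: symm_natural_ar)
    also have "\<one> ?A \<otimes> (\<sigma> ?A A \<cdot> (\<eta> A \<otimes> \<one> ?A)) \<otimes> u A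
        = (\<one> ?A \<otimes> \<sigma> ?A A \<otimes> \<one> K) \<cdot> (\<one> ?A \<otimes> (\<eta> A \<otimes> \<one> ?A) \<otimes> u A)"
      by (simp add: interchange del: tensor_unit_right)
    also have "\<dots> = (\<one> ?A \<otimes> \<sigma> ?A A) \<cdot> ((\<one> ?A \<otimes> \<eta> A) \<otimes> (\<one> ?A \<otimes> u A))"
      by (simp add: tensor_assoc)
    finally have "(\<one> (?A \<otimes>\<^sub>o ?A) \<otimes> (\<eta> A \<otimes> u A)) \<cdot> (?s \<cdot> ?N)
        = (\<one> ?A \<otimes> \<sigma> ?A A) \<cdot> (((\<one> ?A \<otimes> \<eta> A) \<otimes> (\<one> ?A \<otimes> u A)) \<cdot> ?N)"
      by (simp add: comp_assoc_ar flip: comp_assoc_ar[of _ ?s ?N])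
    also have "((\<one> ?A \<otimes> \<eta> A) \<otimes> (\<one> ?A \<otimes> u A)) \<cdot> ?N = d A \<otimes> \<one> ?A"
      by (simp add: interchange mult_unit_right flip: d)
    finally show ?thesis .
  qed
  finally show ?thesis
    \<comment> \<open>The summands arose in the opposite order.\<close>
    using add_commute[of "(\<one> ?A \<otimes> \<sigma> ?A A) \<cdot> (d A \<otimes> \<one> ?A)" "?A \<otimes>\<^sub>o (?A \<otimes>\<^sub>o A)" "?A \<otimes>\<^sub>o ?A" "\<one> ?A \<otimes> d A"]
    by (simp add: Hom_iff)
qed

text \<open>Since \<open>nabla A\<close> factors as \<open>t \<cdot> Ba p\<close>, naturality of
  \<open>d\<close> moves the derivative to \<open>X\<close>, where the Leibniz rule says how it
  meets \<open>\<Delta> X\<close>.\<close>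

lemma Leibniz_imp_nabla_rule:
  assumes [simp]: "A \<in> Ob C" and rule: "Leibniz (Bo A \<otimes>\<^sub>o Bo A)"
  shows "nabla_rule A"
proof -
  define X where "X = Bo A \<otimes>\<^sub>o Bo A"
  let ?A = "Bo A" and ?X = "Bo X"
  have [simp]: "X \<in> Ob C" by (simp add: X_def)
  let ?P\<^sub>0 = "Ba (proj\<^sub>0 A)" and ?P\<^sub>1 = "Ba (proj\<^sub>1 A)"
  let ?p = "?P\<^sub>0 \<otimes> ?P\<^sub>1"
  have [simp]: "Cod C (inj\<^sub>0 A) = X" "Cod C (inj\<^sub>1 A) = X" "Dom C (proj\<^sub>0 A) = X" "Dom C (proj\<^sub>1 A) = X"
    by (simp_all add: X_def)
  define t where "t = (Ba (inj\<^sub>0 A) \<otimes> Ba (inj\<^sub>1 A)) \<cdot> nabla X"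
  have [simp]: "t \<in> Ar C" "Dom C t = ?A \<otimes>\<^sub>o ?A" "Cod C t = ?X"
    by (simp_all add: t_def)
  define p where "p = proj\<^sub>0 A \<oplus> proj\<^sub>1 A"
  have [simp]: "p \<in> Ar C" "Dom C p = X" "Cod C p = A"
    by (simp_all add: p_def)
  have hom: "proj\<^sub>0 A \<in> Hom X A" "proj\<^sub>1 A \<in> Hom X A" "p \<in> Hom X A"
    by (auto simp: Hom_iff)
  have Bp: "Ba p = \<Delta> X \<cdot> ?p \<cdot> nabla A"
    by (simp add: p_def bang_add[OF hom(1,2)])
  have tD: "t \<cdot> (\<Delta> X \<cdot> ?p) = \<one> (?A \<otimes>\<^sub>o ?A)"
    using retract[of A] by (simp add: t_def comp_assoc_ar flip: X_def)
  have tp: "t \<cdot> Ba p = nabla A"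
  proof -
    have "t \<cdot> Ba p = (t \<cdot> (\<Delta> X \<cdot> ?p)) \<cdot> nabla A"
      by (simp add: Bp comp_assoc_ar)
    then show ?thesis by (simp add: tD)
  qed
  have ip: "inj\<^sub>1 A \<cdot> p = \<one> A"
    by (simp add: p_def comp_add_right_ar inj_proj)
  \<comment> \<open>Writing \<open>\<one> A\<close> as \<open>inj\<^sub>1 A \<cdot> p\<close> puts
    the direction of differentiation in the second copy of \<open>A\<close>.\<close>
  have "(nabla A \<otimes> \<one> A) \<cdot> d A = (t \<otimes> inj\<^sub>1 A) \<cdot> ((Ba p \<otimes> p) \<cdot> d A)"
    by (simp add: interchange tp ip flip: comp_assoc_ar)
  also have "\<dots> = (t \<otimes> inj\<^sub>1 A) \<cdot> ((d X \<cdot> \<Delta> X) \<cdot> (?p \<cdot> nabla A))"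
    by (simp only: d_bang[OF hom(3)]) (simp add: Bp comp_assoc_ar)
  also have "\<dots> = ((t \<otimes> inj\<^sub>1 A) \<cdot> ((\<Delta> X \<otimes> \<one> X) \<cdot> ((\<one> ?X \<otimes> d X) \<cdot> ?p)) \<oplus>
      (t \<otimes> inj\<^sub>1 A) \<cdot> ((\<Delta> X \<otimes> \<one> X) \<cdot> ((\<one> ?X \<otimes> \<sigma> ?X X) \<cdot> ((d X \<otimes> \<one> ?X) \<cdot> ?p)))) \<cdot> nabla A"
    using rule[folded X_def] by (simp add: comp_assoc_ar comp_add_left_ar comp_add_right_ar)
  \<comment> \<open>Naturality of \<open>d\<close> at \<open>proj\<^sub>1 A\<close>; the other
    summand will use \<open>proj\<^sub>0 A\<close>.\<close>
  also have "(\<one> ?X \<otimes> d X) \<cdot> ?p = (?p \<otimes> proj\<^sub>1 A) \<cdot> (\<one> ?A \<otimes> d A)"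
  proof -
    have "(\<one> ?X \<otimes> d X) \<cdot> ?p = (?P\<^sub>0 \<otimes> (?P\<^sub>1 \<otimes> proj\<^sub>1 A)) \<cdot> (\<one> ?A \<otimes> d A)"
      by (simp add: interchange d_bang[OF hom(2)])
    then show ?thesis by (simp add: tensor_assoc)
  qed
  also have "(t \<otimes> inj\<^sub>1 A) \<cdot> ((\<Delta> X \<otimes> \<one> X) \<cdot> ((?p \<otimes> proj\<^sub>1 A) \<cdot> (\<one> ?A \<otimes> d A)))
      = ((t \<otimes> inj\<^sub>1 A) \<cdot> ((\<Delta> X \<otimes> \<one> X) \<cdot> (?p \<otimes> proj\<^sub>1 A))) \<cdot> (\<one> ?A \<otimes> d A)"
    by (simp add: comp_assoc_ar)
  also have "(t \<otimes> inj\<^sub>1 A) \<cdot> ((\<Delta> X \<otimes> \<one> X) \<cdot> (?p \<otimes> proj\<^sub>1 A)) = \<one> (?A \<otimes>\<^sub>o ?A \<otimes>\<^sub>o A)"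
    by (simp add: interchange tD inj_proj)
  also have "(\<one> ?X \<otimes> \<sigma> ?X X) \<cdot> ((d X \<otimes> \<one> ?X) \<cdot> ?p)
      = (?p \<otimes> proj\<^sub>0 A) \<cdot> ((\<one> ?A \<otimes> \<sigma> ?A A) \<cdot> (d A \<otimes> \<one> ?A))"
  proof -
    have "(d X \<otimes> \<one> ?X) \<cdot> ?p = (?P\<^sub>0 \<otimes> proj\<^sub>0 A \<otimes> ?P\<^sub>1) \<cdot> (d A \<otimes> \<one> ?A)"
      by (simp add: interchange d_bang[OF hom(1)])
    then have "(\<one> ?X \<otimes> \<sigma> ?X X) \<cdot> ((d X \<otimes> \<one> ?X) \<cdot> ?p)
        = ((\<one> ?X \<otimes> \<sigma> ?X X) \<cdot> (?P\<^sub>0 \<otimes> (proj\<^sub>0 A \<otimes> ?P\<^sub>1))) \<cdot> (d A \<otimes> \<one> ?A)"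
      by (simp add: comp_assoc_ar tensor_assoc)
    also have "(\<one> ?X \<otimes> \<sigma> ?X X) \<cdot> (?P\<^sub>0 \<otimes> (proj\<^sub>0 A \<otimes> ?P\<^sub>1))
        = (?P\<^sub>0 \<otimes> (?P\<^sub>1 \<otimes> proj\<^sub>0 A)) \<cdot> (\<one> ?A \<otimes> \<sigma> ?A A)"
      using symm_natural_ar[of ?P\<^sub>1 "proj\<^sub>0 A"] by (simp add: interchange)
    finally show ?thesis by (simp add: comp_assoc_ar tensor_assoc)
  qed
  also have "(t \<otimes> inj\<^sub>1 A) \<cdot> ((\<Delta> X \<otimes> \<one> X) \<cdot> ((?p \<otimes> proj\<^sub>0 A) \<cdot> ((\<one> ?A \<otimes> \<sigma> ?A A) \<cdot> (d A \<otimes> \<one> ?A))))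
      = ((t \<otimes> inj\<^sub>1 A) \<cdot> ((\<Delta> X \<otimes> \<one> X) \<cdot> (?p \<otimes> proj\<^sub>0 A))) \<cdot> ((\<one> ?A \<otimes> \<sigma> ?A A) \<cdot> (d A \<otimes> \<one> ?A))"
    by (simp add: comp_assoc_ar)
  \<comment> \<open>The direction \<open>inj\<^sub>1 A\<close> has no component along
    \<open>proj\<^sub>0 A\<close>, so the summand differentiating the first factor vanishes.\<close>
  also have "(t \<otimes> inj\<^sub>1 A) \<cdot> ((\<Delta> X \<otimes> \<one> X) \<cdot> (?p \<otimes> proj\<^sub>0 A)) = \<zero> (?A \<otimes>\<^sub>o ?A \<otimes>\<^sub>o A) (?A \<otimes>\<^sub>o ?A \<otimes>\<^sub>o A)"
    by (simp add: interchange tD inj_proj)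
  finally show ?thesis by simp
qed

end

theorem proposition6p7:
  fixes C :: "('o, 'm, 'z) asmc_scheme" (structure)
    and Bo :: "'o \<Rightarrow> 'o" and Ba :: "'m \<Rightarrow> 'm"
    and \<delta> \<epsilon> \<Delta> e nabla u d :: "'o \<Rightarrow> 'm"
  assumes "additive_bialgebra_modality C Bo Ba \<delta> \<epsilon> \<Delta> e nabla u"
    and "natural C (\<lambda>X. Bo X \<otimes>\<^sub>o X) (\<lambda>f. Ba f \<otimes> f) Bo Ba d"
    and linear_rule: "\<And>X. X \<in> Ob C \<Longrightarrow> d X \<cdot> \<epsilon> X = e X \<otimes> \<one> X"
  shows "(\<forall>X \<in> Ob C. d X \<cdot> \<Delta> X =
            (\<Delta> X \<otimes> \<one> X) \<cdot>
              ((\<one> (Bo X) \<otimes> d X) \<oplus> (\<one> (Bo X) \<otimes> \<sigma> (Bo X) X) \<cdot> (d X \<otimes> \<one> (Bo X)))) \<longleftrightarrow>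
         (\<forall>X \<in> Ob C. (nabla X \<otimes> \<one> X) \<cdot> d X = (\<one> (Bo X) \<otimes> d X) \<cdot> nabla X)"
proof -
  interpret linear_rule_transformation C Bo Ba \<delta> \<epsilon> \<Delta> e nabla u d
    using assms by (simp add: linear_rule_transformation_def linear_rule_transformation_axioms_def)
  show ?thesis
    using nabla_rule_imp_Leibniz Leibniz_imp_nabla_rule bang_ob tensor_ob by blast
qed

end
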